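(* Let $n\ge 1$ and $D\ge 1$ be integers, let $S=\mathbb{F}[x_1,\ldots,x_n]$ be a polynomial ring over an arbitrary field $\mathbb{F}$, and consider the module-finite extensions of normal toric rings $V_D\subseteq S\subseteq H_D$, where: (1) $V_D\subseteq S$ is the $D$-th Veronese subring of $S$ with its standard $\mathbb{N}$-grading; and (2) $H_D=\mathbb{F}[z,x_1,\ldots,x_n]/(z^D-x_1\cdots x_n)$ is a hypersurface ring. Then $P^{(D(r-1)+1)}\subseteq P^r$ for all integers $r>0$, where $P$ is any monomial prime ideal in any of the three rings $V_D$, $S$, $H_D$.
   Context: The $D$-th Veronese subring $V_D$ of $S$ is the $\mathbb{F}$-subalgebra generated by all monomials of degree $D$ in $x_1,\ldots,x_n$. A monomial ideal in $S$ (respectively $V_D$) is an ideal generated by monomials in the $x_i$ (respectively, by monomials in the $x_i$ lying in $V_D$); a monomial ideal in $H_D$ is an ideal generated by residue classes of monomials in $z,x_1,\ldots,x_n$. A monomial prime is a monomial ideal that is prime. For a proper ideal $I$ in a nonzero Noetherian ring $A$ and an integer $a>0$, the $a$-th symbolic power is $I^{(a)}=\{f\in A: sf\in I^a\text{ for some }s\in W\}$, where $W=A\setminus\bigcup\{P: P\in\operatorname{Ass}_A(A/I)\}$. *)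

theory Defs
  imports "HOL-Algebra.Algebra" "HOL-Algebra.Algebraic_Closure_Type" "HOL-Library.Poly_Mapping"
begin

section \<open>Symbolic powers of ideals in commutative rings\<close>

text \<open>The quotient \<open>R / I\<close> regarded as an \<open>R\<close>-module.\<close>

definition quot_module :: "('a, 'b) ring_scheme \<Rightarrow> 'a set \<Rightarrow> ('a, 'a set) module"
  where "quot_module R I =
    ring.extend (R Quot I)
      (module.fields (\<lambda>s c. (I +>\<^bsub>R\<^esub> s) \<otimes>\<^bsub>R Quot I\<^esub> c))"

definition annihilator :: "('a, 'b) ring_scheme \<Rightarrow> ('a, 'c, 'd) module_scheme \<Rightarrow> 'c \<Rightarrow> 'a set"
  where "annihilator R M m = {s \<in> carrier R. s \<odot>\<^bsub>M\<^esub> m = \<zero>\<^bsub>M\<^esub>}"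

definition associated_primes :: "('a, 'b) ring_scheme \<Rightarrow> ('a, 'c, 'd) module_scheme \<Rightarrow> 'a set set"
  where "associated_primes R M =
    {Q. primeideal Q R \<and> (\<exists>m \<in> carrier M. Q = annihilator R M m)}"

abbreviation ideal_power :: "('a, 'b) ring_scheme \<Rightarrow> 'a set \<Rightarrow> nat \<Rightarrow> 'a set"
  where "ideal_power R I a \<equiv> I [^]\<^bsub>ideals_set R\<^esub> a"

definition symbolic_power :: "('a, 'b) ring_scheme \<Rightarrow> 'a set \<Rightarrow> nat \<Rightarrow> 'a set"
  where "symbolic_power R I a =
    {f \<in> carrier R.
       \<exists>s \<in> carrier R - \<Union> (associated_primes R (quot_module R I)).
         s \<otimes>\<^bsub>R\<^esub> f \<in> ideal_power R I a}"


section \<open>Monomial primes\<close>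

text \<open>Here \<open>M\<close> is the set of elements of \<open>R\<close> that count as monomials.\<close>

definition monomial_ideal :: "('a, 'b) ring_scheme \<Rightarrow> 'a set \<Rightarrow> 'a set \<Rightarrow> bool"
  where "monomial_ideal R M I \<longleftrightarrow> (\<exists>B \<subseteq> M. I = Idl\<^bsub>R\<^esub> B)"

definition monomial_prime :: "('a, 'b) ring_scheme \<Rightarrow> 'a set \<Rightarrow> 'a set \<Rightarrow> bool"
  where "monomial_prime R M P \<longleftrightarrow> monomial_ideal R M P \<and> primeideal P R"


section \<open>The three families of rings\<close>

text \<open>Polynomials with coefficients in \<open>'k\<close> in variables indexed by \<open>'v\<close>. An exponent vector is a
  finitely supported function \<open>'v \<Rightarrow>\<^sub>0 nat\<close>. For finite \<open>'v\<close> the number of variables is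
  \<open>CARD('v)\<close>, which is at least 1 since types are nonempty.\<close>

type_synonym ('v, 'k) mpoly = "('v \<Rightarrow>\<^sub>0 nat) \<Rightarrow>\<^sub>0 'k"

abbreviation mpoly_ring :: "('v, 'k::field) mpoly ring"
  where "mpoly_ring \<equiv> ring_of_type_algebra"

definition mpoly_const :: "'k::field \<Rightarrow> ('v, 'k) mpoly"
  where "mpoly_const c = Poly_Mapping.single 0 c"

definition mpoly_monomial :: "('v \<Rightarrow>\<^sub>0 nat) \<Rightarrow> ('v, 'k::field) mpoly"
  where "mpoly_monomial m = Poly_Mapping.single m 1"

definition mpoly_var :: "'v \<Rightarrow> ('v, 'k::field) mpoly"
  where "mpoly_var i = mpoly_monomial (Poly_Mapping.single i 1)"

definition monomial_degree :: "('v::finite \<Rightarrow>\<^sub>0 nat) \<Rightarrow> nat"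
  where "monomial_degree m = (\<Sum>i\<in>UNIV. Poly_Mapping.lookup m i)"

definition mpoly_monomials :: "('v, 'k::field) mpoly set"
  where "mpoly_monomials = range mpoly_monomial"

text \<open>The subalgebra generated by a set of polynomials is the subring generated by it together with
  the constants.\<close>

definition veronese_ring :: "nat \<Rightarrow> ('v::finite, 'k::field) mpoly ring"
  where "veronese_ring D = mpoly_ring
    \<lparr>carrier := generate_ring mpoly_ring
       (range mpoly_const \<union> mpoly_monomial ` {m. monomial_degree m = D})\<rparr>"

definition veronese_monomials :: "nat \<Rightarrow> ('v::finite, 'k::field) mpoly set"
  where "veronese_monomials D = mpoly_monomials \<inter> carrier (veronese_ring D)"

text \<open>In \<open>\<FF>[z, x\<^sub>1, \<dots>, x\<^sub>n]\<close> the variables are indexed by \<open>'v option\<close>: the variable \<open>z\<close> is \<open>None\<close>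
  and \<open>x\<^sub>i\<close> is \<open>Some i\<close>.\<close>

definition hypersurface_ideal :: "nat \<Rightarrow> ('v::finite option, 'k::field) mpoly set"
  where "hypersurface_ideal D =
    Idl\<^bsub>mpoly_ring\<^esub> {mpoly_var None ^ D - (\<Prod>i\<in>UNIV. mpoly_var (Some i))}"

definition hypersurface_ring :: "nat \<Rightarrow> ('v::finite option, 'k::field) mpoly set ring"
  where "hypersurface_ring D = mpoly_ring Quot hypersurface_ideal D"

definition hypersurface_monomials :: "nat \<Rightarrow> ('v::finite option, 'k::field) mpoly set set"
  where "hypersurface_monomials D =
    (\<lambda>f. hypersurface_ideal D +>\<^bsub>mpoly_ring\<^esub> f) ` mpoly_monomials"

end

theory Submission
  imports Defs
begin

text \<open>Each of the three rings embeds into \<open>\<FF>[t\<^sub>1, \<dots>, t\<^sub>n]\<close> as the span of the monomials with exponent in a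
  submonoid \<open>M\<close> of \<open>\<nat>\<^sup>n\<close> that contains \<open>D e\<^sub>i\<close> for all \<open>i\<close>. A monomial prime \<open>P\<close> is spanned by the
  monomials whose exponents lie in a prime ideal \<open>Q\<close> of \<open>M\<close>, and since \<open>D q\<close> is a combination of the \<open>D e\<^sub>i\<close>,
  \<open>Q\<close> consists of the exponents involving some variable with index in
  \<open>T = {i. D e\<^sub>i \<in> Q}\<close>. Suppose \<open>w : M \<rightarrow> \<nat>\<close> vanishes at 0, is unchanged by adding elements outside \<open>Q\<close>,
  and grows by at least 1 on adding an element of \<open>Q\<close>, while from each element of \<open>Q\<close> some element of \<open>Q\<close>
  can be split off at a loss of at most \<open>D\<close>. Then \<open>P\<^sup>a\<close> has weight at least \<open>a\<close>; multiplying by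
  \<open>s \<notin> P\<close> does not change the least weight, because the part of \<open>s\<close> outside \<open>P\<close> times the
  lowest part of \<open>f\<close> cannot vanish; and monomials of weight at least \<open>D (r - 1) + 1\<close> lie in \<open>P\<^sup>r\<close>. The degree
  in the variables of \<open>T\<close> is such a weight in all cases except for the hypersurface ring with
  \<open>card T > D\<close>, where the number of factors in the normal form serves instead.\<close>

section \<open>Exponents and supports\<close>

lemma poly_mapping_sum_single:
  fixes f :: "'a \<Rightarrow>\<^sub>0 ('b :: comm_monoid_add)"
  shows "(\<Sum>m\<in>Poly_Mapping.keys f. Poly_Mapping.single m (Poly_Mapping.lookup f m)) = f"
  by (rule poly_mapping_eqI)
    (auto simp: lookup_sum lookup_single when_def not_in_keys_iff_lookup_eq_zero)

text \<open>The single case ranges only over the terms of \<open>f\<close>, so hypotheses on the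
  support of \<open>f\<close> stay available in the induction.\<close>

lemma poly_mapping_induct_single [case_names zero single plus]:
  fixes f :: "'a \<Rightarrow>\<^sub>0 ('b :: comm_monoid_add)"
  assumes "P 0"
    and "\<And>m. m \<in> Poly_Mapping.keys f \<Longrightarrow> P (Poly_Mapping.single m (Poly_Mapping.lookup f m))"
    and "\<And>a b. P a \<Longrightarrow> P b \<Longrightarrow> P (a + b)"
  shows "P f"
proof -
  have "P (\<Sum>m\<in>A. Poly_Mapping.single m (Poly_Mapping.lookup f m))"
    if "finite A" "A \<subseteq> Poly_Mapping.keys f" for A
    using that by (induction A rule: finite_induct) (use assms in auto)
  from this[of "Poly_Mapping.keys f"] show ?thesis
    by (simp add: poly_mapping_sum_single)
qed

text \<open>Uniqueness leaves at most one nonzero term in the convolution sum.\<close>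

lemma lookup_mult_unique:
  fixes f g :: "('a :: monoid_add) \<Rightarrow>\<^sub>0 ('b :: semiring_0)"
  assumes "\<And>a' b'. a' \<in> Poly_Mapping.keys f \<Longrightarrow> b' \<in> Poly_Mapping.keys g \<Longrightarrow> a' + b' = a + b \<Longrightarrow> a' = a \<and> b' = b"
  shows "Poly_Mapping.lookup (f * g) (a + b) = Poly_Mapping.lookup f a * Poly_Mapping.lookup g b"
proof -
  have "Poly_Mapping.lookup (f * g) (a + b) =
    (\<Sum>(x, y). Poly_Mapping.lookup f x * Poly_Mapping.lookup g y when a + b = x + y)"
    unfolding times_poly_mapping.rep_eq by (rule prod_fun_unfold_prod) auto
  also have "\<dots> = (\<Sum>z. (case z of (x, y) \<Rightarrow> Poly_Mapping.lookup f x * Poly_Mapping.lookup g y) when z = (a, b))"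
  proof (rule Sum_any.cong)
    fix z :: "'a \<times> 'a"
    obtain x y where z: "z = (x, y)" by force
    show "(case z of (x, y) \<Rightarrow> Poly_Mapping.lookup f x * Poly_Mapping.lookup g y when a + b = x + y) =
      ((case z of (x, y) \<Rightarrow> Poly_Mapping.lookup f x * Poly_Mapping.lookup g y) when z = (a, b))"
      using assms[of x y] unfolding z when_def
      by (cases "x \<in> Poly_Mapping.keys f \<and> y \<in> Poly_Mapping.keys g")
        (auto simp: not_in_keys_iff_lookup_eq_zero)
  qed
  also have "\<dots> = Poly_Mapping.lookup f a * Poly_Mapping.lookup g b"
    by (simp only: Sum_any_when_equal prod.case)
  finally show ?thesis .
qed

text \<open>The linear extension of \<open>g\<close> to formal sums; for additive \<open>g\<close>,
  the map of monoid algebras that it induces.\<close>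

definition push_exponents :: "('a \<Rightarrow> 'b) \<Rightarrow> ('a \<Rightarrow>\<^sub>0 'c) \<Rightarrow> ('b \<Rightarrow>\<^sub>0 'c::comm_monoid_add)"
  where "push_exponents g f = (\<Sum>m\<in>Poly_Mapping.keys f. Poly_Mapping.single (g m) (Poly_Mapping.lookup f m))"

lemma push_exponents_superset:
  assumes "finite A" "Poly_Mapping.keys f \<subseteq> A"
  shows "push_exponents g f = (\<Sum>m\<in>A. Poly_Mapping.single (g m) (Poly_Mapping.lookup f m))"
  unfolding push_exponents_def using assms
  by (intro sum.mono_neutral_left) (auto simp: not_in_keys_iff_lookup_eq_zero)

lemma push_exponents_0 [simp]: "push_exponents g 0 = 0"
  by (simp add: push_exponents_def)

lemma push_exponents_single [simp]:
  "push_exponents g (Poly_Mapping.single m c) = Poly_Mapping.single (g m) c"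
  by (subst push_exponents_superset[of "{m}"]) auto

lemma push_exponents_add: "push_exponents g (a + b) = push_exponents g a + push_exponents g b"
proof -
  let ?A = "Poly_Mapping.keys a \<union> Poly_Mapping.keys b"
  have "finite ?A" "Poly_Mapping.keys (a + b) \<subseteq> ?A" "Poly_Mapping.keys a \<subseteq> ?A"
      "Poly_Mapping.keys b \<subseteq> ?A"
    using Poly_Mapping.keys_add[of a b] by auto
  then show ?thesis
    by (simp add: push_exponents_superset[of ?A] lookup_add single_add sum.distrib)
qed

lemma push_exponents_diff:
  "push_exponents g (a - b :: _ \<Rightarrow>\<^sub>0 _ :: ab_group_add) = push_exponents g a - push_exponents g b"
  using push_exponents_add[of g "a - b" b] by (simp add: algebra_simps)

lemma push_exponents_mult:
  fixes f g :: "('a :: comm_monoid_add) \<Rightarrow>\<^sub>0 ('b :: comm_semiring_1)"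
  assumes "\<And>m m'. \<phi> (m + m') = \<phi> m + \<phi> m'"
  shows "push_exponents \<phi> (f * g) = push_exponents \<phi> f * push_exponents \<phi> g"
proof (induction f rule: poly_mapping_induct_single)
  case (single m)
  show ?case
    by (induction g rule: poly_mapping_induct_single)
      (auto simp: mult_single assms push_exponents_add distrib_left)
qed (auto simp: push_exponents_add distrib_right)

lemma push_exponents_1: "\<phi> 0 = 0 \<Longrightarrow> push_exponents \<phi> 1 = 1"
  by (metis push_exponents_single single_one)

lemma push_exponents_compose:
  "push_exponents \<phi> (push_exponents \<psi> f) = push_exponents (\<lambda>m. \<phi> (\<psi> m)) f"
  by (induction f rule: poly_mapping_induct_single) (auto simp: push_exponents_add)

lemma push_exponents_ident:
  assumes "\<And>m. m \<in> Poly_Mapping.keys f \<Longrightarrow> \<phi> m = m"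
  shows "push_exponents \<phi> f = f"
  using assms by (simp add: push_exponents_def poly_mapping_sum_single)

lemma keys_push_exponents: "Poly_Mapping.keys (push_exponents \<phi> f) \<subseteq> \<phi> ` Poly_Mapping.keys f"
proof -
  have "Poly_Mapping.keys (push_exponents \<phi> f) \<subseteq>
    (\<Union>m\<in>Poly_Mapping.keys f. Poly_Mapping.keys (Poly_Mapping.single (\<phi> m) (Poly_Mapping.lookup f m)))"
    unfolding push_exponents_def by (rule keys_sum)
  also have "\<dots> \<subseteq> \<phi> ` Poly_Mapping.keys f" by auto
  finally show ?thesis .
qed

text \<open>Kronecker substitution: the new variable gets weight 1, the old ones are scaled by a base
  exceeding all exponents in play.\<close>
lemma separating_weights:
  fixes E :: "('v \<Rightarrow>\<^sub>0 nat) set"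
  assumes "finite V" "finite E"
  shows "\<exists>c. \<forall>a\<in>E. \<forall>b\<in>E.
    (\<Sum>i\<in>V. c i * Poly_Mapping.lookup a i) = (\<Sum>i\<in>V. c i * Poly_Mapping.lookup b i) \<longrightarrow>
    (\<forall>i\<in>V. Poly_Mapping.lookup a i = Poly_Mapping.lookup b i)"
  using assms(1)
proof (induction V rule: finite_induct)
  case (insert v V)
  then obtain c :: "'v \<Rightarrow> nat" where c: "\<forall>a\<in>E. \<forall>b\<in>E.
    (\<Sum>i\<in>V. c i * Poly_Mapping.lookup a i) = (\<Sum>i\<in>V. c i * Poly_Mapping.lookup b i) \<longrightarrow>
    (\<forall>i\<in>V. Poly_Mapping.lookup a i = Poly_Mapping.lookup b i)" by blast
  define B where "B = Suc (Max ((\<lambda>a. Poly_Mapping.lookup a v) ` E))"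
  have B: "Poly_Mapping.lookup a v < B" if "a \<in> E" for a
    using that assms(2) unfolding B_def by (simp add: less_Suc_eq_le)
  define d where "d i = (if i = v then 1 else B * c i)" for i
  have d: "(\<Sum>i\<in>insert v V. d i * Poly_Mapping.lookup a i) =
      Poly_Mapping.lookup a v + B * (\<Sum>i\<in>V. c i * Poly_Mapping.lookup a i)" for a
  proof -
    have "(\<Sum>i\<in>V. d i * Poly_Mapping.lookup a i) = (\<Sum>i\<in>V. B * (c i * Poly_Mapping.lookup a i))"
      using insert.hyps by (intro sum.cong) (auto simp: d_def)
    then show ?thesis
      using insert.hyps by (simp add: d_def sum_distrib_left)
  qed
  have "\<forall>i\<in>insert v V. Poly_Mapping.lookup a i = Poly_Mapping.lookup b i"
    if ab: "a \<in> E" "b \<in> E" and eq: "(\<Sum>i\<in>insert v V. d i * Poly_Mapping.lookup a i) =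
      (\<Sum>i\<in>insert v V. d i * Poly_Mapping.lookup b i)" for a b
  proof -
    let ?s = "\<lambda>a. (\<Sum>i\<in>V. c i * Poly_Mapping.lookup a i)"
    have e: "Poly_Mapping.lookup a v + B * ?s a = Poly_Mapping.lookup b v + B * ?s b"
      using eq unfolding d .
    have "B > 0" by (simp add: B_def)
    have "?s a = (Poly_Mapping.lookup a v + B * ?s a) div B"
      using B[OF ab(1)] by simp
    also have "\<dots> = ?s b"
      unfolding e using B[OF ab(2)] by simp
    finally have s: "?s a = ?s b" .
    with e have "Poly_Mapping.lookup a v = Poly_Mapping.lookup b v" by simp
    moreover have "\<forall>i\<in>V. Poly_Mapping.lookup a i = Poly_Mapping.lookup b i"
      using c[rule_format, OF ab s] by blast
    ultimately show ?thesis by simp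
  qed
  then show ?case by (intro exI[of _ d] ballI impI) blast
qed simp

text \<open>An additive weight that is injective on \<open>A \<union> B\<close> is minimised on each
  set; the sum of the two minimisers arises only once. This later keeps a coefficient of a product
  from cancelling.\<close>

lemma unique_product:
  fixes A B :: "('v :: finite \<Rightarrow>\<^sub>0 nat) set"
  assumes "finite A" "finite B" "A \<noteq> {}" "B \<noteq> {}"
  obtains a b where "a \<in> A" "b \<in> B"
    "\<And>a' b'. a' \<in> A \<Longrightarrow> b' \<in> B \<Longrightarrow> a' + b' = a + b \<Longrightarrow> a' = a \<and> b' = b"
proof -
  obtain c where c: "\<forall>a\<in>A \<union> B. \<forall>b\<in>A \<union> B.
    (\<Sum>i\<in>UNIV. c i * Poly_Mapping.lookup a i) = (\<Sum>i\<in>UNIV. c i * Poly_Mapping.lookup b i) \<longrightarrow>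
    (\<forall>i\<in>UNIV. Poly_Mapping.lookup a i = Poly_Mapping.lookup b i)"
    using separating_weights[OF finite_UNIV finite_UnI[OF assms(1,2)]] by (elim exE)
  define \<phi> where "\<phi> a = (\<Sum>i\<in>UNIV. c i * Poly_Mapping.lookup a i)" for a :: "'v \<Rightarrow>\<^sub>0 nat"
  have inj: "a = b" if "a \<in> A \<union> B" "b \<in> A \<union> B" "\<phi> a = \<phi> b" for a b
    using c[rule_format, OF that(1,2)] that(3) unfolding \<phi>_def by (simp add: poly_mapping_eqI)
  have add: "\<phi> (a + b) = \<phi> a + \<phi> b" for a b
    by (simp add: \<phi>_def lookup_add algebra_simps sum.distrib)
  obtain a where a: "a \<in> A" "\<And>a'. a' \<in> A \<Longrightarrow> \<phi> a \<le> \<phi> a'"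
    using assms by (meson arg_min_if_finite(1) arg_min_least)
  obtain b where b: "b \<in> B" "\<And>b'. b' \<in> B \<Longrightarrow> \<phi> b \<le> \<phi> b'"
    using assms by (meson arg_min_if_finite(1) arg_min_least)
  show thesis
  proof (rule that[OF a(1) b(1)])
    fix a' b' assume *: "a' \<in> A" "b' \<in> B" "a' + b' = a + b"
    have "\<phi> a' + \<phi> b' = \<phi> a + \<phi> b"
      using *(3) by (simp flip: add)
    with a(2)[OF *(1)] b(2)[OF *(2)] have "\<phi> a' = \<phi> a" "\<phi> b' = \<phi> b" by auto
    then show "a' = a \<and> b' = b"
      using inj * a b by blast
  qed
qed

section \<open>Monomial primes in toric rings\<close>

text \<open>The base is all of \<open>M\<close> because the zeroth power of an ideal is the whole
  ring.\<close>

primrec sumset_power :: "('a :: plus) set \<Rightarrow> 'a set \<Rightarrow> nat \<Rightarrow> 'a set" where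
  "sumset_power M Q 0 = M"
| "sumset_power M Q (Suc a) = {p + q | p q. p \<in> sumset_power M Q a \<and> q \<in> Q}"

text \<open>\<open>w\<close> measures how deep an exponent in \<open>M\<close> lies in the prime ideal of exponents that involve some
  variable in \<open>T\<close>.\<close>
definition face_weight ::
    "nat \<Rightarrow> ('v \<Rightarrow>\<^sub>0 nat) set \<Rightarrow> 'v set \<Rightarrow> (('v \<Rightarrow>\<^sub>0 nat) \<Rightarrow> nat) \<Rightarrow> bool" where
  "face_weight D M T w \<longleftrightarrow> w 0 = 0 \<and>
    (\<forall>p\<in>M. \<forall>q\<in>M. (\<forall>i\<in>T. Poly_Mapping.lookup p i = 0) \<longrightarrow> w (p + q) = w q) \<and>
    (\<forall>p\<in>M. \<forall>q\<in>M. (\<exists>i\<in>T. Poly_Mapping.lookup p i > 0) \<longrightarrow> w (p + q) \<ge> w q + 1) \<and>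
    (\<forall>q\<in>M. (\<exists>i\<in>T. Poly_Mapping.lookup q i > 0) \<longrightarrow>
      (\<exists>p\<in>M. \<exists>q'\<in>M. q = q' + p \<and> (\<exists>i\<in>T. Poly_Mapping.lookup p i > 0) \<and> w q \<le> w q' + D))"

section \<open>Powers of a prime ideal of exponents, bounded by weights\<close>

context
  fixes D :: nat and M Q :: "('v \<Rightarrow>\<^sub>0 nat) set" and T w
  assumes w: "face_weight D M T w"
    and zero: "0 \<in> M" and add: "\<And>p q. p \<in> M \<Longrightarrow> q \<in> M \<Longrightarrow> p + q \<in> M"
    and Q: "Q = {q\<in>M. \<exists>i\<in>T. Poly_Mapping.lookup q i > 0}"
begin

lemma sumset_power_weight_ge: "q \<in> sumset_power M Q a \<Longrightarrow> q \<in> M \<and> w q \<ge> a"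
proof (induction a arbitrary: q)
  case (Suc a)
  then obtain p q' where "q = p + q'" "p \<in> sumset_power M Q a" "q' \<in> Q" by auto
  then have pq: "q = q' + p" "p \<in> M" "a \<le> w p" "q' \<in> M"
      "\<exists>i\<in>T. Poly_Mapping.lookup q' i > 0"
    using Suc.IH[of p] unfolding Q by (auto simp: add.commute)
  then have "w q \<ge> w p + 1"
    using w unfolding face_weight_def by blast
  with pq show ?case using add by auto
qed auto

lemma weight_pos:
  assumes "q \<in> M" "w q > 0"
  shows "\<exists>i\<in>T. Poly_Mapping.lookup q i > 0"
proof (rule ccontr)
  assume "\<not> ?thesis"
  then have "\<forall>i\<in>T. Poly_Mapping.lookup q i = 0" by auto
  then have "w (q + 0) = w 0"
    using w zero assms(1) unfolding face_weight_def by blast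
  with assms(2) w show False by (simp add: face_weight_def)
qed

text \<open>Each splitting costs at most \<open>D\<close>, so after \<open>r\<close> of them the
  weight is still at least 1 and the remainder lies in \<open>Q\<close> itself. This gives the extra
  factor in \<open>Suc r\<close>.\<close>

lemma weight_ge_imp_sumset_power:
  assumes "q \<in> M" "w q \<ge> D * r + 1"
  shows "q \<in> sumset_power M Q (Suc r)"
  using assms
proof (induction r arbitrary: q)
  case 0
  have "\<exists>i\<in>T. Poly_Mapping.lookup q i > 0"
    using weight_pos[of q] 0 by simp
  then have "q \<in> Q" using 0 Q by blast
  then have "\<exists>p q'. q = p + q' \<and> p \<in> M \<and> q' \<in> Q"
    by (intro exI[of _ 0] exI[of _ q]) (use zero in auto)
  then show ?case by simp
next
  case (Suc r)
  have "\<exists>i\<in>T. Poly_Mapping.lookup q i > 0"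
    using weight_pos[of q] Suc.prems by simp
  then obtain p q' where pq: "p \<in> M" "q' \<in> M" "q = q' + p" "\<exists>i\<in>T. Poly_Mapping.lookup p i > 0"
      "w q \<le> w q' + D"
    using w Suc.prems unfolding face_weight_def by blast
  have "q' \<in> sumset_power M Q (Suc r)"
    using pq Suc.prems by (intro Suc.IH) auto
  moreover have "p \<in> Q" using pq Q by blast
  ultimately have "\<exists>p' q''. q = p' + q'' \<and> p' \<in> sumset_power M Q (Suc r) \<and> q'' \<in> Q"
    using pq(3) by blast
  then show ?case unfolding sumset_power.simps(2)[of M Q "Suc r"] by blast
qed

end

section \<open>Ideal powers, and symbolic powers of primes\<close>

lemma mpoly_ring_simps [simp]:
  "carrier (ring_of_type_algebra :: ('a :: ring_1) ring) = UNIV"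
  "x \<otimes>\<^bsub>ring_of_type_algebra\<^esub> y = (x * y :: 'a)"
  "x \<oplus>\<^bsub>ring_of_type_algebra\<^esub> y = (x + y :: 'a)"
  "\<zero>\<^bsub>ring_of_type_algebra\<^esub> = (0 :: 'a)"
  "\<one>\<^bsub>ring_of_type_algebra\<^esub> = (1 :: 'a)"
  by (auto simp: ring_of_type_algebra_def)

lemma ideals_set_simps [simp]:
  "\<one>\<^bsub>ideals_set R\<^esub> = carrier R"
  "I \<otimes>\<^bsub>ideals_set R\<^esub> J = ideal_prod R I J"
  by (simp_all add: ideals_set_def)

lemma (in ring) ideal_power_ideal: "ideal I R \<Longrightarrow> ideal (ideal_power R I a) R"
  by (induction a) (simp_all add: oneideal ideal_prod_is_ideal)

text \<open>\<open>P\<close> is the annihilator of the class of 1 in \<open>R / P\<close>, hence an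
  associated prime, so a multiplier that avoids all associated primes avoids
  \<open>P\<close>.\<close>

lemma (in cring) symbolic_power_primeE:
  assumes "primeideal P R" "f \<in> symbolic_power R P a"
  obtains s where "s \<in> carrier R" "s \<notin> P" "f \<in> carrier R" "s \<otimes> f \<in> ideal_power R P a"
proof -
  interpret primeideal P R by fact
  have "annihilator R (quot_module R P) (P +> \<one>) =
      {s \<in> carrier R. (P +> s) \<otimes>\<^bsub>R Quot P\<^esub> (P +> \<one>) = P}"
    by (simp add: annihilator_def quot_module_def ring.defs module.defs FactRing_def)
  also have "\<dots> = {s \<in> carrier R. P +> s = P}"
    using rcoset_mult_add[OF _ one_closed] by (auto simp: FactRing_def)
  also have "\<dots> = P"
  proof -
    have "P +> s = P \<longleftrightarrow> s \<in> P" if "s \<in> carrier R" for s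
      using that a_rcos_const a_rcos_self by metis
    then show ?thesis using Icarr by blast
  qed
  finally have "annihilator R (quot_module R P) (P +> \<one>) = P" .
  moreover have "P +> \<one> \<in> carrier (quot_module R P)"
    by (auto simp: quot_module_def ring.defs module.defs FactRing_def A_RCOSETS_def')
  ultimately have "P \<in> associated_primes R (quot_module R P)"
    unfolding associated_primes_def using assms(1) by blast
  with assms(2) show thesis
    unfolding symbolic_power_def by (auto intro: that)
qed

text \<open>An embedding \<open>h\<close> in place of a subring admits the hypersurface ring, whose
  elements are cosets. That \<open>M\<close> is a submonoid follows, since the image contains 1 and
  is closed under products.\<close>

locale toric_ring = cring R for R (structure) +
  fixes h :: "'a \<Rightarrow> ('v::finite, 'k::field) mpoly" and M :: "('v \<Rightarrow>\<^sub>0 nat) set"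
  assumes hom: "h \<in> ring_hom R mpoly_ring"
    and inj: "inj_on h (carrier R)"
    and image: "h ` carrier R = {g. Poly_Mapping.keys g \<subseteq> M}"
begin

lemma h_mult: "x \<in> carrier R \<Longrightarrow> y \<in> carrier R \<Longrightarrow> h (x \<otimes> y) = h x * h y"
  using ring_hom_mult[OF hom] by simp

lemma h_add: "x \<in> carrier R \<Longrightarrow> y \<in> carrier R \<Longrightarrow> h (x \<oplus> y) = h x + h y"
  using ring_hom_add[OF hom] by simp

lemma h_one: "h \<one> = 1"
  using ring_hom_one[OF hom] by simp

lemma h_zero: "h \<zero> = 0"
  using h_add[of \<zero> \<zero>] by simp

lemma keys_h: "x \<in> carrier R \<Longrightarrow> Poly_Mapping.keys (h x) \<subseteq> M"
  using image by (metis (mono_tags) imageI mem_Collect_eq)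

lemma lift: "Poly_Mapping.keys g \<subseteq> M \<Longrightarrow> \<exists>x\<in>carrier R. h x = g"
  using image by (metis (mono_tags, lifting) imageE mem_Collect_eq)

lemma lift_single: "p \<in> M \<Longrightarrow> \<exists>x\<in>carrier R. h x = Poly_Mapping.single p c"
  by (rule lift) auto

lemma M_zero: "0 \<in> M"
  using keys_h[of \<one>] by (simp add: h_one)

lemma M_add:
  assumes "p \<in> M" "q \<in> M"
  shows "p + q \<in> M"
proof -
  obtain x y where "x \<in> carrier R" "h x = Poly_Mapping.single p 1"
      "y \<in> carrier R" "h y = Poly_Mapping.single q 1"
    using lift_single[of p 1] lift_single[of q 1] assms by auto
  then show ?thesis
    using keys_h[of "x \<otimes> y"] by (simp add: h_mult mult_single)
qed

lemma ideal_lift: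
  assumes "ideal J R"
    and "\<And>m. m \<in> Poly_Mapping.keys g \<Longrightarrow>
      \<exists>x\<in>J. h x = Poly_Mapping.single m (Poly_Mapping.lookup g m)"
  shows "\<exists>x\<in>J. h x = g"
proof -
  interpret ideal J R by fact
  show ?thesis
  proof (induction g rule: poly_mapping_induct_single)
    case zero
    show ?case using h_zero zero_closed by blast
  next
    case (plus a b)
    then show ?case using h_add a_closed Icarr by metis
  qed (use assms in auto)
qed

text \<open>Membership can be tested term by term: the lift found inside \<open>J\<close> has the
  same image as \<open>f\<close>, and \<open>h\<close> is injective.\<close>

lemma ideal_lift_mem:
  assumes "ideal J R" "f \<in> carrier R"
    and "\<And>m. m \<in> Poly_Mapping.keys (h f) \<Longrightarrow>
      \<exists>x\<in>J. h x = Poly_Mapping.single m (Poly_Mapping.lookup (h f) m)"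
  shows "f \<in> J"
  using ideal_lift[OF assms(1,3)] inj assms(1,2) by (metis ideal.Icarr inj_onD)

definition ideal_exponents :: "'a set \<Rightarrow> ('v \<Rightarrow>\<^sub>0 nat) set"
  where "ideal_exponents I = {m. \<exists>f\<in>I. h f = Poly_Mapping.single m 1}"

lemma ideal_exponents_subset:
  assumes "ideal I R"
  shows "ideal_exponents I \<subseteq> M"
proof
  fix m assume "m \<in> ideal_exponents I"
  then obtain f where "f \<in> I" "h f = Poly_Mapping.single m 1"
    unfolding ideal_exponents_def by blast
  with keys_h[of f] ideal.Icarr[OF assms] show "m \<in> M" by simp
qed

text \<open>Multiplication by a preimage of a term: with \<open>p = 0\<close> it rescales
  coefficients, with \<open>c = 1\<close> it shifts exponents.\<close>

lemma ideal_times_single: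
  assumes "ideal J R" "x \<in> J" "h x = Poly_Mapping.single m d" "p \<in> M"
  shows "\<exists>y\<in>J. h y = Poly_Mapping.single (p + m) (c * d)"
proof -
  obtain z where z: "z \<in> carrier R" "h z = Poly_Mapping.single p c"
    using lift_single[OF assms(4)] by blast
  then have "z \<otimes> x \<in> J" "h (z \<otimes> x) = Poly_Mapping.single (p + m) (c * d)"
    using assms h_mult[of z x] ideal.I_l_closed[OF assms(1)] ideal.Icarr[OF assms(1)]
    by (auto simp: mult_single)
  then show ?thesis by blast
qed

text \<open>The elements supported on \<open>ideal_exponents I\<close> form an ideal that contains
  the generators, hence \<open>I\<close>. Conversely each of their terms is a multiple of an element
  of \<open>I\<close>.\<close>

lemma monomial_ideal_iff:
  assumes I: "monomial_ideal R Mon I"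
    and Mon: "\<And>f. f \<in> Mon \<Longrightarrow> f \<in> carrier R \<and> (\<exists>m. h f = Poly_Mapping.single m 1)"
  shows "f \<in> I \<longleftrightarrow> f \<in> carrier R \<and> Poly_Mapping.keys (h f) \<subseteq> ideal_exponents I"
proof -
  obtain B where B: "B \<subseteq> Mon" "I = Idl B"
    using I unfolding monomial_ideal_def by blast
  then have ideal: "ideal I R"
    using Mon by (auto intro!: genideal_ideal)
  let ?Q = "ideal_exponents I"
  let ?J = "{f \<in> carrier R. Poly_Mapping.keys (h f) \<subseteq> ?Q}"
  have mult: "Poly_Mapping.keys (h (x \<otimes> f)) \<subseteq> ?Q" if f: "f \<in> ?J" and x: "x \<in> carrier R" for f x
  proof
    fix m assume "m \<in> Poly_Mapping.keys (h (x \<otimes> f))"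
    then have "m \<in> {p + q | p q. p \<in> Poly_Mapping.keys (h x) \<and> q \<in> Poly_Mapping.keys (h f)}"
      using keys_mult[of "h x" "h f"] f x by (auto simp: h_mult)
    then obtain p q where pq: "m = p + q" "p \<in> M" "q \<in> ?Q"
      using f keys_h[OF x] by blast
    then obtain y where "y \<in> I" "h y = Poly_Mapping.single q 1"
      unfolding ideal_exponents_def by blast
    with ideal_times_single[OF ideal this pq(2), of 1] pq(1) show "m \<in> ?Q"
      by (simp add: ideal_exponents_def)
  qed
  have J: "ideal ?J R"
  proof (rule idealI)
    show "subgroup ?J (add_monoid R)"
    proof (rule add.subgroupI)
      show "?J \<noteq> {}" using h_zero by force
      show "\<ominus> a \<in> ?J" if "a \<in> ?J" for a
        using mult[OF that, of "\<ominus> \<one>"] that by (simp add: l_minus)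
      show "a \<oplus> b \<in> ?J" if "a \<in> ?J" "b \<in> ?J" for a b
        using that Poly_Mapping.keys_add[of "h a" "h b"] by (auto simp: h_add)
    qed auto
  qed (use mult in \<open>auto simp: ring_axioms m_comm\<close>)
  have "B \<subseteq> ?J"
  proof
    fix f assume "f \<in> B"
    moreover from this have "f \<in> I"
      using B Mon genideal_self[of B] by auto
    moreover obtain m where "h f = Poly_Mapping.single m 1" "f \<in> carrier R"
      using Mon[of f] \<open>f \<in> B\<close> B(1) by blast
    ultimately show "f \<in> ?J"
      unfolding ideal_exponents_def by auto
  qed
  from genideal_minimal[OF J this] have "I \<subseteq> ?J"
    by (simp only: B(2))
  moreover have "f \<in> I" if "f \<in> ?J" for f
  proof (rule ideal_lift_mem[OF ideal])
    fix m assume "m \<in> Poly_Mapping.keys (h f)"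
    with that obtain y where "y \<in> I" "h y = Poly_Mapping.single m 1"
      unfolding ideal_exponents_def by auto
    from ideal_times_single[OF ideal this M_zero, of "Poly_Mapping.lookup (h f) m"]
    show "\<exists>x\<in>I. h x = Poly_Mapping.single m (Poly_Mapping.lookup (h f) m)" by simp
  qed (use that in auto)
  ultimately show ?thesis by blast
qed

text \<open>Supports of products lie in sumsets, and sums do not leave them; conversely a term with
  exponent in the sumset is a product of terms already lifted.\<close>

lemma ideal_power_iff:
  assumes ideal: "ideal I R"
    and iff: "\<And>f. f \<in> I \<longleftrightarrow> f \<in> carrier R \<and> Poly_Mapping.keys (h f) \<subseteq> ideal_exponents I"
  shows "f \<in> ideal_power R I a \<longleftrightarrow>
    f \<in> carrier R \<and> Poly_Mapping.keys (h f) \<subseteq> sumset_power M (ideal_exponents I) a"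
proof -
  let ?S = "\<lambda>a. sumset_power M (ideal_exponents I) a"
  have keys: "f \<in> ideal_power R I a \<Longrightarrow> f \<in> carrier R \<and> Poly_Mapping.keys (h f) \<subseteq> ?S a" for f
  proof (induction a arbitrary: f)
    case 0
    then show ?case using keys_h by simp
  next
    case (Suc a)
    from Suc.prems have "f \<in> ideal_prod R (ideal_power R I a) I" by simp
    then show ?case
    proof (induction rule: ideal_prod.induct)
      case (prod i j)
      then have "i \<in> carrier R" "Poly_Mapping.keys (h i) \<subseteq> ?S a"
          "j \<in> carrier R" "Poly_Mapping.keys (h j) \<subseteq> ideal_exponents I"
        using Suc.IH iff by auto
      then show ?case
        using keys_mult[of "h i" "h j"] by (fastforce simp: h_mult)
    next
      case (sum x y)
      then show ?case
        using Poly_Mapping.keys_add[of "h x" "h y"] by (auto simp: h_add)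
    qed
  qed
  have single: "\<exists>x\<in>ideal_power R I a. h x = Poly_Mapping.single m c" if "m \<in> ?S a" for m c
    using that
  proof (induction a arbitrary: m c)
    case 0
    then show ?case
      using lift_single[of m] by simp
  next
    case (Suc a)
    then obtain p q where pq: "m = p + q" "p \<in> ?S a" "q \<in> ideal_exponents I" by auto
    obtain x where x: "x \<in> ideal_power R I a" "h x = Poly_Mapping.single p c"
      using Suc.IH pq by blast
    obtain y where y: "y \<in> I" "h y = Poly_Mapping.single q 1"
      using pq unfolding ideal_exponents_def by blast
    have "x \<otimes> y \<in> ideal_power R I (Suc a)"
      using x y by (auto intro: ideal_prod.prod)
    moreover have "h (x \<otimes> y) = Poly_Mapping.single m c"
      using x y pq keys[of x] iff[of y] ideal ideal_power_ideal[OF ideal, of a]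
      by (simp add: h_mult mult_single ideal.Icarr)
    ultimately show ?case by blast
  qed
  have "f \<in> ideal_power R I a" if "f \<in> carrier R" "Poly_Mapping.keys (h f) \<subseteq> ?S a"
    using that single by (intro ideal_lift_mem[OF ideal_power_ideal[OF ideal]]) auto
  with keys[of f] show ?thesis by blast
qed

text \<open>\<open>ideal_exponents P\<close> is a prime ideal of the monoid \<open>M\<close>, so
  \<open>q\<close> lies in it iff its multiple \<open>D q\<close> does. As a sum of exponents
  \<open>D e_i\<close>, one kind for each variable in \<open>q\<close>, that multiple lies in it iff
  some such \<open>D e_i\<close> does.\<close>

lemma monomial_prime_exponents:
  assumes "monomial_prime R Mon P"
    and Mon: "\<And>f. f \<in> Mon \<Longrightarrow> f \<in> carrier R \<and> (\<exists>m. h f = Poly_Mapping.single m 1)"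
    and D: "\<And>i. Poly_Mapping.single i D \<in> M" "D \<ge> 1"
  obtains T where
    "ideal_exponents P = {q\<in>M. \<exists>i\<in>T. Poly_Mapping.lookup q i > 0}"
proof -
  have P: "monomial_ideal R Mon P" "primeideal P R"
    using assms(1) by (auto simp: monomial_prime_def)
  interpret P: primeideal P R by fact
  let ?Q = "ideal_exponents P"
  have iff: "f \<in> P \<longleftrightarrow> f \<in> carrier R \<and> Poly_Mapping.keys (h f) \<subseteq> ?Q" for f
    using monomial_ideal_iff[OF P(1)] Mon by blast
  have sub: "?Q \<subseteq> M"
    using ideal_exponents_subset P.is_ideal by blast
  have zero: "0 \<notin> ?Q"
  proof
    assume "0 \<in> ?Q"
    then have "\<one> \<in> P"
      unfolding iff by (simp add: h_one)
    then show False
      using P.one_imp_carrier P.I_notcarr by blast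
  qed
  have prime: "p \<in> ?Q \<or> q \<in> ?Q" if pq: "p \<in> M" "q \<in> M" "p + q \<in> ?Q" for p q
  proof -
    obtain x y where xy: "x \<in> carrier R" "h x = Poly_Mapping.single p 1"
        "y \<in> carrier R" "h y = Poly_Mapping.single q 1"
      using lift_single[of p 1] lift_single[of q 1] pq by auto
    have "x \<otimes> y \<in> P"
      unfolding iff using xy pq by (simp add: h_mult mult_single)
    then have "x \<in> P \<or> y \<in> P"
      using xy P.I_prime by blast
    then show ?thesis
      using xy unfolding ideal_exponents_def by blast
  qed
  have add: "p + q \<in> ?Q" if "p \<in> M" "q \<in> ?Q" for p q
  proof -
    obtain y where y: "y \<in> P" "h y = Poly_Mapping.single q 1"
      using \<open>q \<in> ?Q\<close> unfolding ideal_exponents_def by blast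
    show ?thesis
      using ideal_times_single[OF P.is_ideal y \<open>p \<in> M\<close>, of 1] by (simp add: ideal_exponents_def)
  qed
  \<comment> \<open>Repeated sums stand for multiples. The case \<open>n = 0\<close> is excluded
    because 0 is not in \<open>?Q\<close>.\<close>
  have mult: "(\<Sum>i<n. q) \<in> M \<and> ((\<Sum>i<n. q) \<in> ?Q \<longleftrightarrow> n > 0 \<and> q \<in> ?Q)" if "q \<in> M" for q and n :: nat
  proof (induction n)
    case 0
    show ?case using zero M_zero by simp
  next
    case (Suc n)
    let ?s = "\<Sum>i<n. q"
    have "?s + q \<in> M" using Suc that M_add[of ?s q] by simp
    moreover have "?s + q \<in> ?Q \<longleftrightarrow> q \<in> ?Q"
      using prime[of ?s q] add[of ?s q] Suc that by metis
    ultimately show ?case by simp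
  qed
  define T where "T = {i. Poly_Mapping.single i D \<in> ?Q}"
  have sum_iff: "(\<Sum>i\<in>A. \<Sum>j<Poly_Mapping.lookup q i. Poly_Mapping.single i D) \<in> M \<and>
    ((\<Sum>i\<in>A. \<Sum>j<Poly_Mapping.lookup q i. Poly_Mapping.single i D) \<in> ?Q \<longleftrightarrow>
    (\<exists>i\<in>A. i \<in> T \<and> Poly_Mapping.lookup q i > 0))" if "finite A" for A and q :: "'v \<Rightarrow>\<^sub>0 nat"
    using that
  proof (induction A rule: finite_induct)
    case empty
    show ?case using zero M_zero by simp
  next
    case (insert i A)
    let ?s = "\<Sum>j<Poly_Mapping.lookup q i. Poly_Mapping.single i D"
    let ?t = "\<Sum>i\<in>A. \<Sum>j<Poly_Mapping.lookup q i. Poly_Mapping.single i D"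
    have s: "?s \<in> M" "?s \<in> ?Q \<longleftrightarrow> Poly_Mapping.lookup q i > 0 \<and> i \<in> T"
      using mult[OF D(1)[of i], of "Poly_Mapping.lookup q i"] unfolding T_def by auto
    have "?s + ?t \<in> ?Q \<longleftrightarrow> ?s \<in> ?Q \<or> ?t \<in> ?Q"
      using prime[of ?s ?t] add[of ?s ?t] add[of ?t ?s] s insert.IH
      unfolding add.commute[of ?t] by blast
    then show ?case
      unfolding sum.insert[OF insert.hyps] using insert.IH s M_add[of ?s ?t] by blast
  qed
  have "q \<in> ?Q \<longleftrightarrow> (\<exists>i\<in>T. Poly_Mapping.lookup q i > 0)" if "q \<in> M" for q
  proof -
    \<comment> \<open>Both sides are \<open>D q\<close>: \<open>D\<close> copies of
      \<open>q\<close>, or \<open>q_i\<close> copies of \<open>D e_i\<close> for each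
      \<open>i\<close>.\<close>
    have "(\<Sum>i<D. q) = (\<Sum>i\<in>UNIV. \<Sum>j<Poly_Mapping.lookup q i. Poly_Mapping.single i D)"
      by (rule poly_mapping_eqI) (simp add: lookup_sum lookup_single when_def if_distrib cong: if_cong)
    then show ?thesis
      using mult[OF that, of D] sum_iff[OF finite_UNIV, of q] D(2) by (simp, blast)
  qed
  with sub have "?Q = {q\<in>M. \<exists>i\<in>T. Poly_Mapping.lookup q i > 0}" by blast
  then show thesis by (rule that)
qed

text \<open>The weight bound has to be carried from \<open>s \<otimes> f\<close> back to
  \<open>f\<close>: terms of weight at least \<open>D * (r - 1) + 1\<close> lie in the
  \<open>r\<close>-th sumset.\<close>

theorem symbolic_power_subset:
  assumes prime: "monomial_prime R Mon P"
    and Mon: "\<And>f. f \<in> Mon \<Longrightarrow> f \<in> carrier R \<and> (\<exists>m. h f = Poly_Mapping.single m 1)"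
    and D: "\<And>i. Poly_Mapping.single i D \<in> M" "D \<ge> 1"
    and weight: "\<And>T. \<exists>w. face_weight D M T w"
    and "r > 0"
  shows "symbolic_power R P (D * (r - 1) + 1) \<subseteq> ideal_power R P r"
proof
  fix f assume f: "f \<in> symbolic_power R P (D * (r - 1) + 1)"
  have P: "monomial_ideal R Mon P" "primeideal P R"
    using prime by (auto simp: monomial_prime_def)
  interpret P: primeideal P R by fact
  let ?Q = "ideal_exponents P"
  have iff: "f \<in> P \<longleftrightarrow> f \<in> carrier R \<and> Poly_Mapping.keys (h f) \<subseteq> ?Q" for f
    using monomial_ideal_iff[OF P(1)] Mon by blast
  obtain T where T: "?Q = {q\<in>M. \<exists>i\<in>T. Poly_Mapping.lookup q i > 0}"
    using monomial_prime_exponents[OF prime Mon D] .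
  obtain w where w: "face_weight D M T w"
    using weight by blast
  obtain s where s: "s \<in> carrier R" "s \<notin> P" "f \<in> carrier R"
      "s \<otimes> f \<in> ideal_power R P (D * (r - 1) + 1)"
    using symbolic_power_primeE[OF P(2) f] .
  have keys: "D * (r - 1) + 1 \<le> w m" if "m \<in> Poly_Mapping.keys (h s * h f)" for m
  proof -
    have "m \<in> sumset_power M ?Q (D * (r - 1) + 1)"
      using that s(4) unfolding ideal_power_iff[OF P.is_ideal iff] h_mult[OF s(1,3)] by blast
    then show ?thesis
      using sumset_power_weight_ge[OF w M_zero M_add T] by blast
  qed
  have "D * (r - 1) + 1 \<le> w m" if m: "m \<in> Poly_Mapping.keys (h f)" for m
  proof -
    define d where "d = Min (w ` Poly_Mapping.keys (h f))"
    have d: "d \<le> w m'" if "m' \<in> Poly_Mapping.keys (h f)" for m'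
      using that by (simp add: d_def)
    \<comment> \<open>\<open>A\<close> collects the exponents of \<open>s\<close> outside
      \<open>?Q\<close>, nonempty as \<open>s \<notin> P\<close>; \<open>B\<close> collects those of
      \<open>f\<close> of least weight \<open>d\<close>. Sums from \<open>A\<close> and
      \<open>B\<close> have weight \<open>d\<close>, all other sums in the product a larger
      one.\<close>
    define A where "A = Poly_Mapping.keys (h s) - ?Q"
    define B where "B = {m \<in> Poly_Mapping.keys (h f). w m = d}"
    have "finite A" "finite B" by (auto simp: A_def B_def)
    moreover have "A \<noteq> {}"
      using s iff[of s] by (auto simp: A_def)
    moreover have "d \<in> w ` Poly_Mapping.keys (h f)"
      unfolding d_def using m by (intro Min_in) auto
    then have "B \<noteq> {}" by (auto simp: B_def)
    ultimately obtain a b where ab: "a \<in> A" "b \<in> B"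
      and uniq: "\<And>a' b'. a' \<in> A \<Longrightarrow> b' \<in> B \<Longrightarrow> a' + b' = a + b \<Longrightarrow> a' = a \<and> b' = b"
      using unique_product by blast
    have wA: "w (a' + b') = w b'" if "a' \<in> A" "b' \<in> M" for a' b'
    proof -
      have "a' \<in> M" "\<forall>i\<in>T. Poly_Mapping.lookup a' i = 0"
        using that keys_h[OF s(1)] unfolding A_def T by auto
      with that w show ?thesis unfolding face_weight_def by blast
    qed
    have wQ: "w (a' + b') \<ge> w b' + 1" if "a' \<in> ?Q" "b' \<in> M" for a' b'
      using that w unfolding face_weight_def T by blast
    have B_M: "b' \<in> M" if "b' \<in> Poly_Mapping.keys (h f)" for b'
      using that keys_h[OF s(3)] by blast
    have wab: "w (a + b) = d"
      using wA[OF ab(1), of b] ab(2) B_M by (auto simp: B_def)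
    have "Poly_Mapping.lookup (h s * h f) (a + b) =
        Poly_Mapping.lookup (h s) a * Poly_Mapping.lookup (h f) b"
    proof (rule lookup_mult_unique)
      fix a' b' assume *: "a' \<in> Poly_Mapping.keys (h s)" "b' \<in> Poly_Mapping.keys (h f)" "a' + b' = a + b"
      have "a' \<in> A"
        using wQ[of a' b'] *(1,3) d[OF *(2)] wab B_M[OF *(2)] by (auto simp: A_def)
      moreover from this have "b' \<in> B"
        using wA[of a' b'] *(2,3) wab B_M[OF *(2)] by (auto simp: B_def)
      ultimately show "a' = a \<and> b' = b"
        using uniq *(3) by blast
    qed
    also have "\<dots> \<noteq> 0"
      using ab by (auto simp: A_def B_def in_keys_iff)
    \<comment> \<open>The surviving term has weight \<open>d\<close>, so the bound on the product
      bounds \<open>d\<close>, and with it every \<open>w m\<close>.\<close>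
    finally have "a + b \<in> Poly_Mapping.keys (h s * h f)"
      by (simp add: in_keys_iff)
    from keys[OF this] wab d[OF m] show ?thesis by simp
  qed
  then have "Poly_Mapping.keys (h f) \<subseteq> sumset_power M ?Q (Suc (r - 1))"
    using weight_ge_imp_sumset_power[OF w M_zero M_add T] keys_h[OF s(3)] by blast
  moreover have "Suc (r - 1) = r" using \<open>r > 0\<close> by simp
  ultimately show "f \<in> ideal_power R P r"
    unfolding ideal_power_iff[OF P.is_ideal iff] using s(3) by metis
qed

end

lemma cring_mpoly_ring: "cring (mpoly_ring :: ('v, 'k::field) mpoly ring)"
  by (rule cring_from_type_algebra)

section \<open>Degree in a set of variables as a weight\<close>

lemma split_exponent:
  fixes q p :: "'v \<Rightarrow>\<^sub>0 nat"
  assumes "\<And>i. Poly_Mapping.lookup p i \<le> Poly_Mapping.lookup q i"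
  obtains q' where "q = q' + p" "\<And>i. Poly_Mapping.lookup q' i = Poly_Mapping.lookup q i - Poly_Mapping.lookup p i"
proof (rule that[of "q - p"])
  show "q = q - p + p"
    using assms by (intro poly_mapping_eqI) (simp add: lookup_add lookup_minus)
qed (simp add: lookup_minus)

text \<open>The degree in \<open>T\<close> is additive, which settles every clause of
  \<open>face_weight\<close> but the splitting; there it suffices that the part split off has degree
  at most \<open>D\<close> in \<open>T\<close>.\<close>

lemma degree_face_weight:
  fixes M :: "('v::finite \<Rightarrow>\<^sub>0 nat) set"
  assumes "\<And>q i. q \<in> M \<Longrightarrow> i \<in> T \<Longrightarrow> Poly_Mapping.lookup q i > 0 \<Longrightarrow>
    \<exists>p\<in>M. \<exists>q'\<in>M. q = q' + p \<and> (\<exists>i\<in>T. Poly_Mapping.lookup p i > 0) \<and> (\<Sum>i\<in>T. Poly_Mapping.lookup p i) \<le> D"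
  shows "face_weight D M T (\<lambda>q. \<Sum>i\<in>T. Poly_Mapping.lookup q i)"
  unfolding face_weight_def
proof (intro conjI ballI impI)
  fix p q :: "'v \<Rightarrow>\<^sub>0 nat"
  assume "\<exists>i\<in>T. Poly_Mapping.lookup p i > 0"
  then have "(\<Sum>i\<in>T. Poly_Mapping.lookup p i) > 0"
    by (auto simp: sum_pos2)
  then show "(\<Sum>i\<in>T. Poly_Mapping.lookup q i) + 1 \<le> (\<Sum>i\<in>T. Poly_Mapping.lookup (p + q) i)"
    by (simp add: lookup_add sum.distrib)
next
  fix q assume "q \<in> M" "\<exists>i\<in>T. Poly_Mapping.lookup q i > 0"
  with assms obtain p q' where "p \<in> M" "q' \<in> M" "q = q' + p" "\<exists>i\<in>T. Poly_Mapping.lookup p i > 0"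
      "(\<Sum>i\<in>T. Poly_Mapping.lookup p i) \<le> D"
    by metis
  then show "\<exists>p\<in>M. \<exists>q'\<in>M. q = q' + p \<and> (\<exists>i\<in>T. Poly_Mapping.lookup p i > 0) \<and>
      (\<Sum>i\<in>T. Poly_Mapping.lookup q i) \<le> (\<Sum>i\<in>T. Poly_Mapping.lookup q' i) + D"
    by (intro bexI[of _ p] bexI[of _ q']) (auto simp: lookup_add sum.distrib)
qed (auto simp: lookup_add sum.distrib)

section \<open>Polynomial rings and Veronese rings\<close>

lemma monomial_degree_0 [simp]: "monomial_degree 0 = 0"
  by (simp add: monomial_degree_def)

lemma monomial_degree_add: "monomial_degree (p + q) = monomial_degree p + monomial_degree q"
  by (simp add: monomial_degree_def lookup_add sum.distrib)

lemma monomial_degree_single [simp]: "monomial_degree (Poly_Mapping.single i n) = n"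
  by (simp add: monomial_degree_def lookup_single when_def)

lemma monomial_degree_pos: "monomial_degree q > 0 \<Longrightarrow> \<exists>i. Poly_Mapping.lookup q i > 0"
  by (rule ccontr) (simp add: monomial_degree_def)

text \<open>One variable at a time is moved from \<open>q'\<close> to \<open>p\<close>. Starting
  with the variable \<open>i\<close> guarantees that \<open>p\<close> involves it.\<close>

lemma split_degree:
  assumes "Poly_Mapping.lookup q i > 0" "1 \<le> d" "d \<le> monomial_degree q"
  shows "\<exists>p q'. q = q' + p \<and> monomial_degree p = d \<and> Poly_Mapping.lookup p i > 0"
  using assms(2,3)
proof (induction d rule: dec_induct)
  case base
  obtain q' where "q = q' + Poly_Mapping.single i 1"
    by (rule split_exponent[of "Poly_Mapping.single i 1" q])
      (use assms(1) in \<open>auto simp: lookup_single when_def\<close>)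
  then show ?case by (intro exI[of _ "Poly_Mapping.single i 1"] exI[of _ q']) simp
next
  case (step d)
  then obtain p q' where pq: "q = q' + p" "monomial_degree p = d" "Poly_Mapping.lookup p i > 0"
    by auto
  then have "monomial_degree q' > 0"
    using step.prems by (simp add: monomial_degree_add)
  then obtain j where j: "Poly_Mapping.lookup q' j > 0"
    using monomial_degree_pos by blast
  obtain q'' where "q' = q'' + Poly_Mapping.single j 1"
    by (rule split_exponent[of "Poly_Mapping.single j 1" q'])
      (use j in \<open>auto simp: lookup_single when_def\<close>)
  then show ?case
    using pq by (intro exI[of _ "p + Poly_Mapping.single j 1"] exI[of _ q''])
      (simp add: monomial_degree_add lookup_add algebra_simps)
qed

lemma toric_ring_mpoly_ring: "toric_ring (mpoly_ring :: ('v::finite, 'k::field) mpoly ring) id UNIV"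
  by (intro toric_ring.intro toric_ring_axioms.intro cring_mpoly_ring) (auto intro: ring_hom_memI)

text \<open>Ring operations keep degrees divisible by \<open>D\<close>; conversely a monomial of
  degree \<open>D * a\<close> factors into \<open>a\<close> monomials of degree
  \<open>D\<close>.\<close>

lemma carrier_veronese_ring:
  "carrier (veronese_ring D :: ('v::finite, 'k::field) mpoly ring) =
    {f. Poly_Mapping.keys f \<subseteq> {m. D dvd monomial_degree m}}" (is "?V = {f. _ \<subseteq> ?M}")
proof -
  interpret S: cring "mpoly_ring :: ('v, 'k) mpoly ring" by (rule cring_mpoly_ring)
  define G :: "('v, 'k) mpoly set" where
    "G = range mpoly_const \<union> mpoly_monomial ` {m. monomial_degree m = D}"
  have V: "?V = generate_ring mpoly_ring G"
    by (simp add: veronese_ring_def G_def)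
  have "Poly_Mapping.keys f \<subseteq> ?M" if "f \<in> generate_ring mpoly_ring G" for f
    using that
  proof (induction rule: generate_ring.induct)
    case (incl h)
    then show ?case by (auto simp: G_def mpoly_const_def mpoly_monomial_def split: if_splits)
  next
    case (a_inv h)
    have "\<ominus>\<^bsub>mpoly_ring\<^esub> h = - h"
      by (rule S.minus_equality) auto
    with a_inv show ?case by (auto simp: in_keys_iff)
  next
    case (eng_add f g)
    then show ?case using Poly_Mapping.keys_add[of f g] by auto
  next
    case (eng_mult f g)
    show ?case
    proof (intro subsetI)
      fix m assume "m \<in> Poly_Mapping.keys (f \<otimes>\<^bsub>mpoly_ring\<^esub> g)"
      then obtain p q where "m = p + q" "p \<in> Poly_Mapping.keys f" "q \<in> Poly_Mapping.keys g"
        using keys_mult[of f g] by auto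
      moreover from this have "p \<in> ?M" "q \<in> ?M"
        using eng_mult.IH by blast+
      ultimately show "m \<in> ?M" by (simp add: monomial_degree_add)
    qed
  qed auto
  moreover have "f \<in> generate_ring mpoly_ring G" if f: "Poly_Mapping.keys f \<subseteq> ?M" for f
  proof -
    have generated: "Poly_Mapping.single m c \<in> generate_ring mpoly_ring G" if "monomial_degree m = D * a" for m c a
      using that
    proof (induction a arbitrary: m)
      case 0
      then have "m = 0"
        by (intro poly_mapping_eqI) (simp add: monomial_degree_def)
      then have "Poly_Mapping.single m c \<in> G"
        by (simp add: G_def mpoly_const_def)
      then show ?case by (rule generate_ring.incl)
    next
      case (Suc a)
      show ?case
      proof (cases "D = 0")
        \<comment> \<open>With \<open>D = 0\<close> the degree is 0 at either stage, so the
          induction hypothesis applies directly.\<close>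
        case True
        with Suc show ?thesis by simp
      next
        case False
        with Suc.prems have "monomial_degree m > 0" by simp
        then obtain i where i: "Poly_Mapping.lookup m i > 0"
          using monomial_degree_pos by blast
        have "1 \<le> D" "D \<le> monomial_degree m"
          using False Suc.prems by auto
        from split_degree[OF i this] obtain p q where pq: "m = q + p" "monomial_degree p = D"
          by blast
        have "monomial_degree q = D * a"
          using Suc.prems pq by (simp add: monomial_degree_add)
        then have "Poly_Mapping.single q c \<in> generate_ring mpoly_ring G"
          by (rule Suc.IH)
        moreover have "Poly_Mapping.single p 1 \<in> generate_ring mpoly_ring G"
          using pq by (intro generate_ring.incl) (auto simp: G_def mpoly_monomial_def)
        ultimately have "Poly_Mapping.single q c * Poly_Mapping.single p 1 \<in> generate_ring mpoly_ring G"
          using generate_ring.eng_mult[of "Poly_Mapping.single q c" mpoly_ring G "Poly_Mapping.single p 1"]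
          by simp
        then show ?thesis by (simp add: mult_single pq)
      qed
    qed
    show ?thesis
    proof (induction f rule: poly_mapping_induct_single)
      case zero
      show ?case using S.zero_in_generate by simp
    next
      case (single m)
      then have "D dvd monomial_degree m" using f by blast
      then show ?case using generated by (auto elim!: dvdE)
    next
      case (plus a b)
      then show ?case using generate_ring.eng_add[of a mpoly_ring G b] by simp
    qed
  qed
  ultimately show ?thesis unfolding V by blast
qed

lemma toric_ring_veronese_ring:
  "toric_ring (veronese_ring D :: ('v::finite, 'k::field) mpoly ring) id {m. D dvd monomial_degree m}"
proof -
  interpret S: cring "mpoly_ring :: ('v, 'k) mpoly ring" by (rule cring_mpoly_ring)
  define G :: "('v, 'k) mpoly set" where
    "G = range mpoly_const \<union> mpoly_monomial ` {m. monomial_degree m = D}"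
  have "subcring (generate_ring mpoly_ring G) mpoly_ring"
    by (intro S.subcringI' S.generate_ring_is_subring) simp
  then have "cring (veronese_ring D :: ('v, 'k) mpoly ring)"
    using S.subcring_iff[of "generate_ring mpoly_ring G"] by (simp add: veronese_ring_def G_def)
  then show ?thesis
  proof (intro toric_ring.intro toric_ring_axioms.intro)
    show "id \<in> ring_hom (veronese_ring D) (mpoly_ring :: ('v, 'k) mpoly ring)"
      by (rule ring_hom_memI) (simp_all add: veronese_ring_def)
  qed (simp_all add: carrier_veronese_ring)
qed

text \<open>The weight, supplied by unification with \<open>degree_face_weight\<close>, is the
  degree in \<open>T\<close>; a single variable from \<open>T\<close> splits off at a loss of
  1.\<close>

lemma mpoly_ring_face_weight:
  fixes T :: "'v::finite set"
  assumes "D \<ge> 1"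
  shows "\<exists>w. face_weight D UNIV T w"
proof (rule exI, rule degree_face_weight)
  fix q :: "'v \<Rightarrow>\<^sub>0 nat" and i assume i: "i \<in> T" "Poly_Mapping.lookup q i > 0"
  obtain q' where "q = q' + Poly_Mapping.single i 1"
    by (rule split_exponent[of "Poly_Mapping.single i 1" q])
      (use i in \<open>auto simp: lookup_single when_def\<close>)
  with i assms show "\<exists>p\<in>UNIV. \<exists>q'\<in>UNIV. q = q' + p \<and> (\<exists>i\<in>T. Poly_Mapping.lookup p i > 0) \<and>
      (\<Sum>i\<in>T. Poly_Mapping.lookup p i) \<le> D"
    by (intro bexI[of _ "Poly_Mapping.single i 1"] bexI[of _ q'])
      (auto simp: lookup_single when_def)
qed

text \<open>Again the degree in \<open>T\<close>: a monomial of positive degree divisible by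
  \<open>D\<close> has a factor of degree exactly \<open>D\<close> through any of its
  variables.\<close>

lemma veronese_face_weight:
  fixes T :: "'v::finite set"
  assumes "D \<ge> 1"
  shows "\<exists>w. face_weight D {m. D dvd monomial_degree m} T w"
proof (rule exI, rule degree_face_weight)
  fix q :: "'v \<Rightarrow>\<^sub>0 nat" and i
  assume q: "q \<in> {m. D dvd monomial_degree m}" and i: "i \<in> T" "Poly_Mapping.lookup q i > 0"
  have "monomial_degree q \<noteq> 0"
    using i by (auto simp: monomial_degree_def)
  with q have "D \<le> monomial_degree q"
    by (auto dest: dvd_imp_le)
  with split_degree[OF i(2) assms] obtain p q' where
    pq: "q = q' + p" "monomial_degree p = D" "Poly_Mapping.lookup p i > 0" by blast
  have "D dvd monomial_degree q'"
    using q pq by (simp add: monomial_degree_add)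
  moreover have "(\<Sum>i\<in>T. Poly_Mapping.lookup p i) \<le> monomial_degree p"
    unfolding monomial_degree_def by (rule sum_mono2) auto
  ultimately show "\<exists>p\<in>{m. D dvd monomial_degree m}. \<exists>q'\<in>{m. D dvd monomial_degree m}.
      q = q' + p \<and> (\<exists>i\<in>T. Poly_Mapping.lookup p i > 0) \<and> (\<Sum>i\<in>T. Poly_Mapping.lookup p i) \<le> D"
    using pq i by (intro bexI[of _ p] bexI[of _ q']) auto
qed

section \<open>Hypersurface rings\<close>

text \<open>Substituting \<open>x\<^sub>i = t\<^sub>i\<^sup>D\<close> and \<open>z = t\<^sub>1 \<cdots> t\<^sub>n\<close> embeds the hypersurface ring into
  \<open>\<FF>[t\<^sub>1, \<dots>, t\<^sub>n]\<close>; its image is spanned by the monomials whose exponents are congruent modulo \<open>D\<close>.\<close>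

definition hypersurface_exponents :: "nat \<Rightarrow> ('v \<Rightarrow>\<^sub>0 nat) set" where
  "hypersurface_exponents D = {q. \<forall>i j. Poly_Mapping.lookup q i mod D = Poly_Mapping.lookup q j mod D}"

definition hypersurface_embedding :: "nat \<Rightarrow> ('v::finite option \<Rightarrow>\<^sub>0 nat) \<Rightarrow> ('v \<Rightarrow>\<^sub>0 nat)" where
  "hypersurface_embedding D m =
    Abs_poly_mapping (\<lambda>i. D * Poly_Mapping.lookup m (Some i) + Poly_Mapping.lookup m None)"

text \<open>The unique preimage with \<open>z\<close>-exponent below \<open>D\<close>. The residue is the same in all coordinates, so
  it may be read off at an arbitrary one.\<close>
definition hypersurface_normal_form :: "nat \<Rightarrow> ('v::finite \<Rightarrow>\<^sub>0 nat) \<Rightarrow> ('v option \<Rightarrow>\<^sub>0 nat)" where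
  "hypersurface_normal_form D e = Abs_poly_mapping
    (case_option (Poly_Mapping.lookup e undefined mod D) (\<lambda>i. Poly_Mapping.lookup e i div D))"

lemma lookup_hypersurface_embedding [simp]:
  "Poly_Mapping.lookup (hypersurface_embedding D m) i =
    D * Poly_Mapping.lookup m (Some i) + Poly_Mapping.lookup m None"
  by (simp add: hypersurface_embedding_def)

lemma lookup_hypersurface_normal_form [simp]:
  "Poly_Mapping.lookup (hypersurface_normal_form D e) None = Poly_Mapping.lookup e undefined mod D"
  "Poly_Mapping.lookup (hypersurface_normal_form D e) (Some i) = Poly_Mapping.lookup e i div D"
  by (simp_all add: hypersurface_normal_form_def)

lemma hypersurface_embedding_add:
  "hypersurface_embedding D (p + q) = hypersurface_embedding D p + hypersurface_embedding D q"
  by (rule poly_mapping_eqI) (simp add: lookup_add algebra_simps)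

lemma hypersurface_embedding_0 [simp]: "hypersurface_embedding D 0 = 0"
  by (rule poly_mapping_eqI) simp

lemma hypersurface_embedding_in: "hypersurface_embedding D m \<in> hypersurface_exponents D"
  by (simp add: hypersurface_exponents_def)

lemma hypersurface_embedding_normal_form:
  assumes "e \<in> hypersurface_exponents D"
  shows "hypersurface_embedding D (hypersurface_normal_form D e) = e"
proof (rule poly_mapping_eqI)
  fix i
  have "Poly_Mapping.lookup e undefined mod D = Poly_Mapping.lookup e i mod D"
    using assms unfolding hypersurface_exponents_def by blast
  then show "Poly_Mapping.lookup (hypersurface_embedding D (hypersurface_normal_form D e)) i =
      Poly_Mapping.lookup e i"
    by simp
qed

lemma hypersurface_normal_form_embedding:
  assumes "Poly_Mapping.lookup m None < D"
  shows "hypersurface_normal_form D (hypersurface_embedding D m) = m"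
proof (rule poly_mapping_eqI)
  fix i
  show "Poly_Mapping.lookup (hypersurface_normal_form D (hypersurface_embedding D m)) i =
      Poly_Mapping.lookup m i"
    using assms by (cases i) auto
qed

lemma mpoly_var_power: "mpoly_var i ^ n = Poly_Mapping.single (Poly_Mapping.single i n) 1"
  by (induction n) (simp_all add: mpoly_var_def mpoly_monomial_def mult_single flip: single_add)

lemma prod_single_one:
  fixes g :: "'i \<Rightarrow> 'a :: comm_monoid_add"
  shows "(\<Prod>i\<in>A. Poly_Mapping.single (g i) (1 :: 'k :: comm_semiring_1)) = Poly_Mapping.single (\<Sum>i\<in>A. g i) 1"
  by (induction A rule: infinite_finite_induct) (auto simp: mult_single)

lemma mpoly_ring_ideal_closed:
  fixes I :: "('v, 'k::field) mpoly set"
  assumes "ideal I mpoly_ring"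
  shows "0 \<in> I" "a \<in> I \<Longrightarrow> b \<in> I \<Longrightarrow> a + b \<in> I" "a \<in> I \<Longrightarrow> x * a \<in> I"
proof -
  interpret ideal I mpoly_ring by fact
  show "0 \<in> I"
    using additive_subgroup.zero_closed[OF ideal.axioms(1)[OF assms]] by simp
  show "a \<in> I \<Longrightarrow> b \<in> I \<Longrightarrow> a + b \<in> I"
    using additive_subgroup.a_closed[OF ideal.axioms(1)[OF assms], of a b] by simp
  show "a \<in> I \<Longrightarrow> x * a \<in> I"
    using I_l_closed[of a x] by simp
qed

section \<open>The hypersurface ring as the image of the substitution\<close>

context
  fixes D :: nat and I :: "('v::finite option, 'k::field) mpoly set"
    and \<phi> :: "('v option, 'k) mpoly \<Rightarrow> ('v, 'k) mpoly"
  assumes D: "D \<ge> 1"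
  defines "I \<equiv> hypersurface_ideal D"
    and "\<phi> \<equiv> push_exponents (hypersurface_embedding D)"
begin

definition relation_exponent :: "'v option \<Rightarrow>\<^sub>0 nat" where
  "relation_exponent = (\<Sum>i\<in>UNIV. Poly_Mapping.single (Some i) 1)"

lemma lookup_relation_exponent:
  "Poly_Mapping.lookup relation_exponent i = (if i = None then 0 else 1)"
  by (cases i) (auto simp: relation_exponent_def lookup_sum lookup_single when_def)

lemma hypersurface_ideal_alt:
  "I = Idl\<^bsub>mpoly_ring\<^esub> {Poly_Mapping.single (Poly_Mapping.single None D) 1 - Poly_Mapping.single relation_exponent 1}"
  unfolding I_def hypersurface_ideal_def mpoly_var_power
  unfolding mpoly_var_def mpoly_monomial_def prod_single_one relation_exponent_def ..

lemma ideal_hypersurface_ideal: "ideal I mpoly_ring"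
  unfolding hypersurface_ideal_alt
  using cring.axioms(1)[OF cring_mpoly_ring] by (intro ring.genideal_ideal) auto

lemma hypersurface_generator:
  "Poly_Mapping.single (Poly_Mapping.single None D) 1 - Poly_Mapping.single relation_exponent 1 \<in> I"
  unfolding hypersurface_ideal_alt
  using ring.genideal_self[OF cring.axioms(1)[OF cring_mpoly_ring]] by auto

text \<open>Replacing \<open>z^D\<close> by \<open>x_1 ... x_n\<close> preserves the class modulo
  \<open>I\<close> and the image exponent, and lowers the \<open>z\<close>-exponent by
  \<open>D \<ge> 1\<close>, on which the induction runs.\<close>

lemma single_congruent_normal_form:
  "Poly_Mapping.single m 1 -
    Poly_Mapping.single (hypersurface_normal_form D (hypersurface_embedding D m)) 1 \<in> I"
proof (induction "Poly_Mapping.lookup m None" arbitrary: m rule: less_induct)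
  case less
  show ?case
  proof (cases "Poly_Mapping.lookup m None < D")
    case True
    then show ?thesis
      using mpoly_ring_ideal_closed(1)[OF ideal_hypersurface_ideal]
      by (simp add: hypersurface_normal_form_embedding)
  next
    case False
    obtain m' where m': "m = m' + Poly_Mapping.single None D"
      by (rule split_exponent[of "Poly_Mapping.single None D" m])
        (use False in \<open>auto simp: lookup_single when_def\<close>)
    let ?m = "m' + relation_exponent"
    have "hypersurface_embedding D ?m = hypersurface_embedding D m"
      by (rule poly_mapping_eqI)
        (simp add: m' lookup_add lookup_relation_exponent lookup_single when_def algebra_simps)
    moreover have "Poly_Mapping.lookup ?m None < Poly_Mapping.lookup m None"
      using D by (simp add: m' lookup_add lookup_relation_exponent)
    ultimately have IH: "Poly_Mapping.single ?m 1 -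
        Poly_Mapping.single (hypersurface_normal_form D (hypersurface_embedding D m)) 1 \<in> I"
      using less.hyps[of ?m] by simp
    have "Poly_Mapping.single m 1 - Poly_Mapping.single ?m 1 \<in> I"
    proof -
      have "Poly_Mapping.single m 1 - Poly_Mapping.single ?m 1 = Poly_Mapping.single m' 1 *
        (Poly_Mapping.single (Poly_Mapping.single None D) 1 - Poly_Mapping.single relation_exponent (1 :: 'k))"
        by (simp add: m' right_diff_distrib mult_single)
      then show ?thesis
        using mpoly_ring_ideal_closed(3)[OF ideal_hypersurface_ideal hypersurface_generator] by simp
    qed
    from mpoly_ring_ideal_closed(2)[OF ideal_hypersurface_ideal this IH] show ?thesis by simp
  qed
qed

lemma congruent_normal_form:
  "f - push_exponents (\<lambda>m. hypersurface_normal_form D (hypersurface_embedding D m)) f \<in> I"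
proof (induction f rule: poly_mapping_induct_single)
  case zero
  show ?case using mpoly_ring_ideal_closed(1)[OF ideal_hypersurface_ideal] by simp
next
  case (single m)
  show ?case
    using mpoly_ring_ideal_closed(3)[OF ideal_hypersurface_ideal single_congruent_normal_form[of m],
        of "Poly_Mapping.single 0 (Poly_Mapping.lookup f m)"]
    by (simp add: right_diff_distrib mult_single)
next
  case (plus a b)
  then show ?case
    using mpoly_ring_ideal_closed(2)[OF ideal_hypersurface_ideal plus]
    by (simp add: push_exponents_add algebra_simps)
qed

lemma ring_hom_ring_hypersurface: "ring_hom_ring mpoly_ring mpoly_ring \<phi>"
  unfolding \<phi>_def
  by (intro ring_hom_ringI cring.axioms(1)[OF cring_mpoly_ring])
    (simp_all add: push_exponents_add push_exponents_mult hypersurface_embedding_add push_exponents_1)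

text \<open>The normal form factors through \<open>\<phi>\<close>, so an \<open>f\<close> with zero
  image is congruent to 0.\<close>

lemma hypersurface_embedding_kernel:
  assumes "\<phi> f = 0"
  shows "f \<in> I"
proof -
  have "push_exponents (\<lambda>m. hypersurface_normal_form D (hypersurface_embedding D m)) f =
      push_exponents (hypersurface_normal_form D) (\<phi> f)"
    unfolding \<phi>_def push_exponents_compose ..
  with congruent_normal_form[of f] assms show ?thesis by simp
qed

lemma push_hypersurface_generator:
  "\<phi> (Poly_Mapping.single (Poly_Mapping.single None D) 1 - Poly_Mapping.single relation_exponent 1) = 0"
proof -
  have "hypersurface_embedding D (Poly_Mapping.single None D) = hypersurface_embedding D relation_exponent"
    by (rule poly_mapping_eqI) (simp add: lookup_relation_exponent lookup_single when_def)
  then show ?thesis by (simp add: \<phi>_def push_exponents_diff)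
qed

lemma kernel_hypersurface: "a_kernel mpoly_ring mpoly_ring \<phi> = I"
proof
  show "a_kernel mpoly_ring mpoly_ring \<phi> \<subseteq> I"
    using hypersurface_embedding_kernel by (auto simp: a_kernel_def')
  show "I \<subseteq> a_kernel mpoly_ring mpoly_ring \<phi>"
    unfolding hypersurface_ideal_alt
    using push_hypersurface_generator
    by (intro ring.genideal_minimal[OF cring.axioms(1)[OF cring_mpoly_ring]]
        ring_hom_ring.kernel_is_ideal[OF ring_hom_ring_hypersurface])
      (simp add: a_kernel_def')
qed

text \<open>The first isomorphism theorem: \<open>\<phi>\<close> is constant on each coset of its
  kernel, and \<open>the_elem\<close> extracts that value.\<close>

lemma toric_ring_hypersurface_ring:
  "toric_ring (hypersurface_ring D) (\<lambda>c. the_elem (\<phi> ` c)) (hypersurface_exponents D)"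
proof -
  interpret ring_hom_ring mpoly_ring mpoly_ring \<phi> by (rule ring_hom_ring_hypersurface)
  have H: "hypersurface_ring D = mpoly_ring Quot (a_kernel mpoly_ring mpoly_ring \<phi>)"
    by (simp add: hypersurface_ring_def kernel_hypersurface I_def)
  have "\<phi> ` UNIV = {g. Poly_Mapping.keys g \<subseteq> hypersurface_exponents D}"
  proof (intro equalityI subsetI)
    fix g assume "g \<in> \<phi> ` UNIV"
    then obtain f where "g = \<phi> f" by blast
    then show "g \<in> {g. Poly_Mapping.keys g \<subseteq> hypersurface_exponents D}"
      using keys_push_exponents[of "hypersurface_embedding D" f] hypersurface_embedding_in[of D]
      by (auto simp: \<phi>_def)
  next
    fix g :: "('v, 'k) mpoly" assume "g \<in> {g. Poly_Mapping.keys g \<subseteq> hypersurface_exponents D}"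
    \<comment> \<open>The normal form is a right inverse of the embedding on
      \<open>hypersurface_exponents D\<close>, which yields a preimage of \<open>g\<close>.\<close>
    then have "\<phi> (push_exponents (hypersurface_normal_form D) g) = g"
      unfolding \<phi>_def push_exponents_compose
      by (intro push_exponents_ident hypersurface_embedding_normal_form) auto
    then show "g \<in> \<phi> ` UNIV" by (metis rangeI)
  qed
  then show ?thesis
    unfolding H
    by (intro toric_ring.intro toric_ring_axioms.intro ideal.quotient_is_cring[OF kernel_is_ideal]
        cring_mpoly_ring the_elem_hom inj_onI the_elem_inj)
      (simp_all add: the_elem_surj)
qed

lemma hypersurface_monomials_toric:
  assumes "f \<in> hypersurface_monomials D"
  shows "f \<in> carrier (hypersurface_ring D)"
    and "\<exists>m. the_elem (\<phi> ` f) = Poly_Mapping.single m 1"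
proof -
  interpret ring_hom_ring mpoly_ring mpoly_ring \<phi> by (rule ring_hom_ring_hypersurface)
  obtain m where f: "f = I +>\<^bsub>mpoly_ring\<^esub> Poly_Mapping.single m 1"
    using assms by (auto simp: hypersurface_monomials_def mpoly_monomials_def mpoly_monomial_def I_def)
  show "f \<in> carrier (hypersurface_ring D)"
    unfolding f by (auto simp: hypersurface_ring_def FactRing_def A_RCOSETS_def' I_def)
  have "the_elem (\<phi> ` f) = \<phi> (Poly_Mapping.single m 1)"
    unfolding f kernel_hypersurface[symmetric] by (rule the_elem_simp) simp
  then show "\<exists>m. the_elem (\<phi> ` f) = Poly_Mapping.single m 1"
    by (auto simp: \<phi>_def)
qed

end

text \<open>If some coordinate in \<open>T\<close> reaches \<open>D\<close>, then
  \<open>x_j\<close>, with exponent \<open>D e_j\<close>, splits off. Otherwise the common residue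
  is the positive number \<open>q_i\<close>, so every coordinate is at least 1 and \<open>z\<close>,
  with all exponents 1, splits off.\<close>

lemma split_hypersurface_exponent:
  fixes q :: "'v::finite \<Rightarrow>\<^sub>0 nat"
  assumes D: "D \<ge> 1" and q: "q \<in> hypersurface_exponents D"
    and i: "i \<in> T" "Poly_Mapping.lookup q i > 0"
  obtains p q' where "p \<in> hypersurface_exponents D" "q' \<in> hypersurface_exponents D" "q = q' + p"
    and "(\<exists>j\<in>T. p = Poly_Mapping.single j D) \<or>
      ((\<forall>j. Poly_Mapping.lookup p j = 1) \<and> (\<forall>j\<in>T. Poly_Mapping.lookup q j < D))"
proof (cases "\<exists>j\<in>T. Poly_Mapping.lookup q j \<ge> D")
  case True
  then obtain j where j: "j \<in> T" "Poly_Mapping.lookup q j \<ge> D" by blast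
  let ?p = "Poly_Mapping.single j D"
  obtain q' where q': "q = q' + ?p"
    by (rule split_exponent[of ?p q]) (use j in \<open>auto simp: lookup_single when_def\<close>)
  have p: "Poly_Mapping.lookup ?p k mod D = 0" for k
    by (simp add: lookup_single when_def)
  have "Poly_Mapping.lookup q' k mod D = Poly_Mapping.lookup q k mod D" for k
    unfolding q' by (simp add: lookup_add lookup_single when_def)
  then have "q' \<in> hypersurface_exponents D"
    using q by (simp add: hypersurface_exponents_def)
  moreover have "?p \<in> hypersurface_exponents D"
    using p by (simp add: hypersurface_exponents_def)
  ultimately show thesis
    using that q' j by blast
next
  case False
  define p :: "'v \<Rightarrow>\<^sub>0 nat" where "p = Abs_poly_mapping (\<lambda>_. 1)"
  have p: "Poly_Mapping.lookup p j = 1" for j by (simp add: p_def)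
  have res: "Poly_Mapping.lookup q k mod D = Poly_Mapping.lookup q i" for k
  proof -
    have "Poly_Mapping.lookup q k mod D = Poly_Mapping.lookup q i mod D"
      using q unfolding hypersurface_exponents_def by blast
    also have "\<dots> = Poly_Mapping.lookup q i"
      using False i(1) by (simp add: not_le)
    finally show ?thesis .
  qed
  have pos: "Poly_Mapping.lookup q k \<ge> 1" for k
    using res[of k] i(2) by (cases "Poly_Mapping.lookup q k = 0") auto
  obtain q' where q': "q = q' + p"
      "\<And>k. Poly_Mapping.lookup q' k = Poly_Mapping.lookup q k - Poly_Mapping.lookup p k"
    by (rule split_exponent[of p q]) (use p pos in auto)
  \<comment> \<open>The common residue is positive, so removing 1 from each coordinate needs no
    borrowing and the residues stay equal.\<close>
  have "Poly_Mapping.lookup q' k mod D = Poly_Mapping.lookup q i - 1" for k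
  proof -
    have "Poly_Mapping.lookup q k =
        D * (Poly_Mapping.lookup q k div D) + Poly_Mapping.lookup q i"
      using res[of k] by (metis mult_div_mod_eq)
    then have "Poly_Mapping.lookup q' k =
        D * (Poly_Mapping.lookup q k div D) + (Poly_Mapping.lookup q i - 1)"
      using i(2) by (simp add: q'(2) p)
    moreover have "Poly_Mapping.lookup q i - 1 < D"
      using False i(1) by (meson leI less_imp_diff_less)
    ultimately show ?thesis by simp
  qed
  then have "q' \<in> hypersurface_exponents D"
    by (simp add: hypersurface_exponents_def)
  moreover have "p \<in> hypersurface_exponents D"
    using p by (simp add: hypersurface_exponents_def)
  ultimately show thesis
    using that[of p q'] q'(1) p False by (auto simp: not_le)
qed

text \<open>If the prime contains at least \<open>D\<close> of the \<open>x\<^sub>i\<close>, replacing \<open>z\<^sup>D\<close> by \<open>x\<^sub>1 \<cdots> x\<^sub>n\<close> only raises the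
  number of factors in \<open>P\<close>, so that number, read off the normal form with \<open>z\<close>-exponent below \<open>D\<close>, is the right weight.\<close>
lemma normal_form_face_weight:
  fixes T :: "'v::finite set"
  assumes D: "D \<ge> 1" and T: "D \<le> card T" and t: "t \<in> T"
  shows "face_weight D (hypersurface_exponents D) T
    (\<lambda>q. (\<Sum>i\<in>T. Poly_Mapping.lookup q i div D) + Poly_Mapping.lookup q t mod D)"
    (is "face_weight D ?M T ?w")
  unfolding face_weight_def
proof (intro conjI ballI impI)
  fix p q :: "'v \<Rightarrow>\<^sub>0 nat" assume "\<forall>i\<in>T. Poly_Mapping.lookup p i = 0"
  then show "?w (p + q) = ?w q"
    using t by (simp add: lookup_add)
next
  fix p q :: "'v \<Rightarrow>\<^sub>0 nat" assume M: "p \<in> ?M" "q \<in> ?M" and "\<exists>i\<in>T. Poly_Mapping.lookup p i > 0"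
  then obtain i where i: "i \<in> T" "Poly_Mapping.lookup p i > 0" by blast
  define a b where "a = Poly_Mapping.lookup p t mod D" and "b = Poly_Mapping.lookup q t mod D"
  have res: "Poly_Mapping.lookup p k mod D = a" "Poly_Mapping.lookup q k mod D = b" for k
    using M unfolding hypersurface_exponents_def a_def b_def by blast+
  \<comment> \<open>Residues agree across coordinates, so each coordinate has the same carry
    \<open>(a + b) div D\<close>.\<close>
  have "Poly_Mapping.lookup (p + q) k div D =
      Poly_Mapping.lookup p k div D + Poly_Mapping.lookup q k div D + (a + b) div D" for k
    by (simp only: lookup_add div_add1_eq[of "Poly_Mapping.lookup p k"] res)
  then have "(\<Sum>k\<in>T. Poly_Mapping.lookup (p + q) k div D) =
      (\<Sum>k\<in>T. Poly_Mapping.lookup p k div D) + (\<Sum>k\<in>T. Poly_Mapping.lookup q k div D) + card T * ((a + b) div D)"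
    by (simp add: sum.distrib)
  moreover have "Poly_Mapping.lookup (p + q) t mod D = (a + b) mod D"
    by (simp add: lookup_add a_def b_def mod_add_eq)
  \<comment> \<open>A carry trades \<open>D\<close> factors \<open>z\<close> for one
    \<open>x_k\<close> for each \<open>k \<in> T\<close>, which is no loss as
    \<open>D \<le> card T\<close>.\<close>
  moreover have "D * ((a + b) div D) \<le> card T * ((a + b) div D)"
    using T by simp
  moreover have "D * ((a + b) div D) + (a + b) mod D = a + b"
    by simp
  \<comment> \<open>\<open>p\<close> has at least one factor: if its residue vanishes, the positive
    coordinate at \<open>i\<close> is at least \<open>D\<close>.\<close>
  moreover have "(\<Sum>k\<in>T. Poly_Mapping.lookup p k div D) + a \<ge> 1"
  proof (cases "a = 0")
    case True
    with res[of i] i D have "Poly_Mapping.lookup p i div D > 0"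
      by (metis dvd_imp_le div_greater_zero_iff mod_eq_0_iff_dvd less_eq_Suc_le One_nat_def)
    then have "(\<Sum>k\<in>T. Poly_Mapping.lookup p k div D) > 0"
      using i by (auto simp: sum_pos2)
    then show ?thesis by simp
  qed auto
  ultimately show "?w q + 1 \<le> ?w (p + q)"
    unfolding b_def[symmetric] by linarith
next
  fix q assume q: "q \<in> ?M" "\<exists>i\<in>T. Poly_Mapping.lookup q i > 0"
  then obtain i where i: "i \<in> T" "Poly_Mapping.lookup q i > 0" by blast
  obtain p q' where pq: "p \<in> ?M" "q' \<in> ?M" "q = q' + p"
    and cases: "(\<exists>j\<in>T. p = Poly_Mapping.single j D) \<or>
      ((\<forall>j. Poly_Mapping.lookup p j = 1) \<and> (\<forall>j\<in>T. Poly_Mapping.lookup q j < D))"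
    by (rule split_hypersurface_exponent[OF D q(1) i])
  have "?w q \<le> ?w q' + D \<and> (\<exists>i\<in>T. Poly_Mapping.lookup p i > 0)"
    using cases
  proof (elim disjE bexE conjE)
    fix j assume j: "j \<in> T" "p = Poly_Mapping.single j D"
    have "(\<Sum>i\<in>T. Poly_Mapping.lookup q i div D) =
        (\<Sum>i\<in>T. Poly_Mapping.lookup q' i div D + (if i = j then 1 else 0))"
      using D by (intro sum.cong) (auto simp: pq(3) j lookup_add lookup_single when_def)
    also have "\<dots> = (\<Sum>i\<in>T. Poly_Mapping.lookup q' i div D) + 1"
      using j by (simp add: sum.distrib)
    finally have "(\<Sum>i\<in>T. Poly_Mapping.lookup q i div D) = \<dots>" .
    moreover have "Poly_Mapping.lookup q t mod D = Poly_Mapping.lookup q' t mod D"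
      by (simp add: pq(3) j lookup_add lookup_single when_def)
    moreover have "Poly_Mapping.lookup p j > 0"
      using j D by simp
    ultimately show ?thesis
      using j(1) D by auto
  next
    assume p: "\<forall>j. Poly_Mapping.lookup p j = 1" and "\<forall>j\<in>T. Poly_Mapping.lookup q j < D"
    \<comment> \<open>On \<open>T\<close> all quotients vanish, so the weight is the residue at
      \<open>t\<close>, which is below \<open>D\<close>.\<close>
    then have "?w q \<le> D" using t by (simp add: less_imp_le)
    with p t show ?thesis by auto
  qed
  with pq show "\<exists>p\<in>?M. \<exists>q'\<in>?M. q = q' + p \<and> (\<exists>i\<in>T. Poly_Mapping.lookup p i > 0) \<and> ?w q \<le> ?w q' + D"
    by blast
qed simp

text \<open>For \<open>card T \<le> D\<close> the degree in \<open>T\<close> works: the parts that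
  can be split off, \<open>x_j\<close> and \<open>z\<close>, have degrees \<open>D\<close> and
  \<open>card T\<close> in \<open>T\<close>.\<close>

lemma hypersurface_face_weight:
  fixes T :: "'v::finite set"
  assumes D: "D \<ge> 1"
  shows "\<exists>w. face_weight D (hypersurface_exponents D) T w"
proof (cases "card T \<le> D")
  case True
  show ?thesis
  proof (rule exI, rule degree_face_weight)
    fix q :: "'v \<Rightarrow>\<^sub>0 nat" and i
    assume q: "q \<in> hypersurface_exponents D" and i: "i \<in> T" "Poly_Mapping.lookup q i > 0"
    obtain p q' where pq: "p \<in> hypersurface_exponents D" "q' \<in> hypersurface_exponents D" "q = q' + p"
      and cases: "(\<exists>j\<in>T. p = Poly_Mapping.single j D) \<or>
        ((\<forall>j. Poly_Mapping.lookup p j = 1) \<and> (\<forall>j\<in>T. Poly_Mapping.lookup q j < D))"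
      by (rule split_hypersurface_exponent[OF D q i])
    have "(\<exists>i\<in>T. Poly_Mapping.lookup p i > 0) \<and> (\<Sum>i\<in>T. Poly_Mapping.lookup p i) \<le> D"
      using cases
    proof (elim disjE bexE conjE)
      fix j assume "j \<in> T" "p = Poly_Mapping.single j D"
      then show ?thesis using D by (auto simp: lookup_single when_def)
    qed (use i True in auto)
    with pq show "\<exists>p\<in>hypersurface_exponents D. \<exists>q'\<in>hypersurface_exponents D. q = q' + p \<and>
        (\<exists>i\<in>T. Poly_Mapping.lookup p i > 0) \<and> (\<Sum>i\<in>T. Poly_Mapping.lookup p i) \<le> D"
      by blast
  qed
next
  case False
  then obtain t where "t \<in> T" by (metis card.empty le0 ex_in_conv)
  with normal_form_face_weight[OF D _ this] False show ?thesis by (meson nat_le_linear)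
qed

lemma single_in_hypersurface_exponents: "Poly_Mapping.single i D \<in> hypersurface_exponents D"
  by (auto simp: hypersurface_exponents_def lookup_single when_def)

section \<open>The three rings as instances of the toric case\<close>

theorem theorem1p3:
  fixes D r :: nat
  assumes "D \<ge> 1" and "r > 0"
  shows
    "(\<forall>P :: ('n::finite, 'k::field) mpoly set.
        monomial_prime (veronese_ring D) (veronese_monomials D) P \<longrightarrow>
        symbolic_power (veronese_ring D) P (D * (r - 1) + 1) \<subseteq> ideal_power (veronese_ring D) P r)
     \<and>
     (\<forall>P :: ('n, 'k) mpoly set.
        monomial_prime mpoly_ring mpoly_monomials P \<longrightarrow>
        symbolic_power mpoly_ring P (D * (r - 1) + 1) \<subseteq> ideal_power mpoly_ring P r)
     \<and>
     (\<forall>P :: ('n option, 'k) mpoly set set.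
        monomial_prime (hypersurface_ring D) (hypersurface_monomials D) P \<longrightarrow>
        symbolic_power (hypersurface_ring D) P (D * (r - 1) + 1) \<subseteq> ideal_power (hypersurface_ring D) P r)"
proof (intro conjI allI impI)
  fix P :: "('n, 'k) mpoly set"
  assume "monomial_prime (veronese_ring D) (veronese_monomials D) P"
  then show "symbolic_power (veronese_ring D) P (D * (r - 1) + 1) \<subseteq> ideal_power (veronese_ring D) P r"
  proof (rule toric_ring.symbolic_power_subset[OF toric_ring_veronese_ring])
    show "f \<in> carrier (veronese_ring D) \<and> (\<exists>m. id f = Poly_Mapping.single m 1)"
      if "f \<in> veronese_monomials D" for f :: "('n, 'k) mpoly"
      using that by (auto simp: veronese_monomials_def mpoly_monomials_def mpoly_monomial_def)
  qed (use assms veronese_face_weight in auto)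
next
  fix P :: "('n, 'k) mpoly set"
  assume "monomial_prime mpoly_ring mpoly_monomials P"
  then show "symbolic_power mpoly_ring P (D * (r - 1) + 1) \<subseteq> ideal_power mpoly_ring P r"
  proof (rule toric_ring.symbolic_power_subset[OF toric_ring_mpoly_ring])
    show "f \<in> carrier mpoly_ring \<and> (\<exists>m. id f = Poly_Mapping.single m 1)"
      if "f \<in> mpoly_monomials" for f :: "('n, 'k) mpoly"
      using that by (auto simp: mpoly_monomials_def mpoly_monomial_def)
  qed (use assms mpoly_ring_face_weight in auto)
next
  fix P :: "('n option, 'k) mpoly set set"
  assume "monomial_prime (hypersurface_ring D) (hypersurface_monomials D) P"
  then show "symbolic_power (hypersurface_ring D) P (D * (r - 1) + 1) \<subseteq> ideal_power (hypersurface_ring D) P r"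
    by (rule toric_ring.symbolic_power_subset[OF toric_ring_hypersurface_ring[OF assms(1)]])
      (use assms hypersurface_monomials_toric hypersurface_face_weight single_in_hypersurface_exponents
        in \<open>auto intro: hypersurface_monomials_toric\<close>)
qed

end
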